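(* For homeomorphisms, the inequality $K_{CT,p,y_0}(y,g)\leqslant K_{I,p}(y,g^{-1})$ is in general strict on a set of positive Lebesgue measure: there exist a homeomorphism $g$ of a planar domain onto a planar domain and a point $y_0$ such that, for $p=n=2$, the set of points $y$ at which $K_{CT,2,y_0}(y,g)<1\leqslant K_{I,2}(y,g^{-1})$ has positive Lebesgue measure. Specifically, let $D\subset\mathbb{C}$ be a domain with $0\in D$, let $f:D\to\mathbb{C}$ be a homeomorphism onto its image, and let $x\in D\setminus\{0\}$ be a point at which $f$ is differentiable with nonzero Jacobian and $\mu(x)=\frac12\cdot\frac{x}{\overline{x}}$. Then $$K_{CT,2,0}(x,f^{-1})=\frac13<1,$$ while $K_{I,2}(x,f)\geqslant1$, where $K_{I,2}(x,f)$ is the quantity $K_{I,2}(y,g^{-1})$ for $g=f^{-1}$ and $y=x$.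
   Context: Here $(\cdot,\cdot)$ is the Euclidean scalar product, $J(z,g)=\det g'(z)$, $\Vert g'(z)\Vert=\max_{h\neq0}\frac{|g'(z)h|}{|h|}$, and $\mathbb{C}$ is identified with $\mathbb{R}^2$. For a homeomorphism $g$ of a domain in $\mathbb{R}^n$ onto its image in $\mathbb{R}^n$, a point $y_0\in\mathbb{R}^n$, and $y=g(z)\neq y_0$ such that $g$ is differentiable at $z$ with $J(z,g)\neq0$, put $$K_{CT,p,y_0}(y,g)=\frac{\left(\sup_{|h|=1}\left|\left(g'(z)h,\frac{g(z)-y_0}{|g(z)-y_0|}\right)\right|\right)^p}{|J(z,g)|},\qquad K_{I,p}(y,g^{-1})=\frac{\Vert g'(z)\Vert^p}{|J(z,g)|}.$$ For $x=x_1+ix_2$ and a mapping $f$ differentiable at $x$, $f_x=(f_{x_1}-if_{x_2})/2$, $f_{\overline{x}}=(f_{x_1}+if_{x_2})/2$, and $\mu(x)=f_{\overline{x}}/f_x$ if $f_x\neq0$, $\mu(x)=0$ if $f_x=0$. *)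

theory Defs
  imports "HOL-Analysis.Analysis"
begin

text \<open>The space $\mathbb{R}^n$ is any type of class \<open>euclidean_space\<close>; for the planar statements it
  is the type \<open>complex\<close>, whose inner product is that of $\mathbb{R}^2$.  The library's \<open>det\<close> only
  accepts matrices indexed by types, so the determinant of a linear map is taken by the Leibniz
  formula over the orthonormal basis \<open>Basis\<close>.  It agrees with \<open>det\<close>, see \<open>det_linear_vec\<close>.\<close>

definition det_linear :: "('a::euclidean_space \<Rightarrow> 'a) \<Rightarrow> real" where
  "det_linear L = (\<Sum>p | p permutes Basis. of_int (sign p) * (\<Prod>b\<in>Basis. L (p b) \<bullet> b))"

definition Jacobian :: "'a::euclidean_space \<Rightarrow> ('a \<Rightarrow> 'a) \<Rightarrow> real" where
  "Jacobian z g = det_linear (frechet_derivative g (at z))"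

definition is_domain :: "'a::euclidean_space set \<Rightarrow> bool" where
  "is_domain D \<longleftrightarrow> open D \<and> connected D \<and> D \<noteq> {}"

definition homeo_onto_image :: "'a::euclidean_space set \<Rightarrow> ('a \<Rightarrow> 'a) \<Rightarrow> bool" where
  "homeo_onto_image U g \<longleftrightarrow> homeomorphism U (g ` U) g (the_inv_into U g)"

text \<open>A mapping of \<open>U\<close> is a total function \<open>g\<close> whose values outside \<open>U\<close> are irrelevant (\<open>U\<close> is
  open, so derivatives at points of \<open>U\<close> do not see them).  The point \<open>y = g z\<close> determines
  \<open>z = the_inv_into U g y\<close>.\<close>

definition K_CT :: "real \<Rightarrow> 'a::euclidean_space \<Rightarrow> 'a set \<Rightarrow> ('a \<Rightarrow> 'a) \<Rightarrow> 'a \<Rightarrow> real" where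
  "K_CT p y0 U g y =
     (let z = the_inv_into U g y in
      (SUP h\<in>{h. norm h = 1}.
         \<bar>frechet_derivative g (at z) h \<bullet> ((g z - y0) /\<^sub>R norm (g z - y0))\<bar>) powr p
      / \<bar>Jacobian z g\<bar>)"

text \<open>\<open>K_I_inv p U g y\<close> is $K_{I,p}(y, g^{-1})$: the mapping passed as an argument is \<open>g\<close> itself.
  The library's \<open>onorm L\<close> is the supremum of \<open>norm (L h) / norm h\<close>; the term \<open>h = 0\<close>
  contributes \<open>0 / 0 = 0\<close>, and in finite dimension the supremum is a maximum.\<close>

definition K_I_inv :: "real \<Rightarrow> 'a::euclidean_space set \<Rightarrow> ('a \<Rightarrow> 'a) \<Rightarrow> 'a \<Rightarrow> real" where
  "K_I_inv p U g y =
     (let z = the_inv_into U g y in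
      onorm (frechet_derivative g (at z)) powr p / \<bar>Jacobian z g\<bar>)"

text \<open>The points \<open>y\<close> at which both quantities are defined.\<close>

definition K_defined_at :: "'a::euclidean_space \<Rightarrow> 'a set \<Rightarrow> ('a \<Rightarrow> 'a) \<Rightarrow> 'a \<Rightarrow> bool" where
  "K_defined_at y0 U g y \<longleftrightarrow>
     y \<in> g ` U \<and> y \<noteq> y0 \<and>
     g differentiable (at (the_inv_into U g y)) \<and> Jacobian (the_inv_into U g y) g \<noteq> 0"

definition partial1 :: "(complex \<Rightarrow> complex) \<Rightarrow> complex \<Rightarrow> complex" where
  "partial1 f x = vector_derivative (\<lambda>t::real. f (x + of_real t)) (at 0)"

definition partial2 :: "(complex \<Rightarrow> complex) \<Rightarrow> complex \<Rightarrow> complex" where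
  "partial2 f x = vector_derivative (\<lambda>t::real. f (x + of_real t * \<i>)) (at 0)"

definition wirtinger :: "(complex \<Rightarrow> complex) \<Rightarrow> complex \<Rightarrow> complex" where
  "wirtinger f x = (partial1 f x - \<i> * partial2 f x) / 2"

definition wirtinger_bar :: "(complex \<Rightarrow> complex) \<Rightarrow> complex \<Rightarrow> complex" where
  "wirtinger_bar f x = (partial1 f x + \<i> * partial2 f x) / 2"

definition dilatation :: "(complex \<Rightarrow> complex) \<Rightarrow> complex \<Rightarrow> complex" where
  "dilatation f x = (if wirtinger f x \<noteq> 0 then wirtinger_bar f x / wirtinger f x else 0)"

lemma det_linear_complex:
  "det_linear L = Re (L 1) * Im (L \<i>) - Im (L 1) * Re (L \<i>)" for L :: "complex \<Rightarrow> complex"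
proof -
  have "finite {\<i>}" "1 \<notin> {\<i>}"
    by simp_all
  then show ?thesis
    unfolding det_linear_def Basis_complex_def
    by (simp add: sum_over_permutations_insert permutes_sing sign_swap_id
        sign_compose transpose_apply_first transpose_apply_second)
qed

lemma det_linear_vec:
  "det_linear L = det (matrix L)" for L :: "real ^ 'n \<Rightarrow> real ^ 'n"
proof -
  let ?a = "\<lambda>i::'n. axis i (1::real)"
  have inj: "inj ?a"
    by (auto simp: inj_def axis_eq_axis)
  have bas: "(Basis :: (real ^ 'n) set) = range ?a"
    by (auto simp: Basis_vec_def)
  have bij: "bij_betw ?a UNIV (Basis :: (real ^ 'n) set)"
    using inj by (simp add: bij_betw_def bas)
  have bijm: "bij_betw (map_permutation UNIV ?a) {p. p permutes UNIV}
      {p. p permutes (Basis :: (real ^ 'n) set)}"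
  proof -
    have "map_permutation UNIV ?a = (\<lambda>p x. if x \<in> (Basis :: (real ^ 'n) set)
        then ?a (p (inv_into UNIV ?a x)) else x)"
      by (auto simp: map_permutation_def fun_eq_iff restrict_id_def bas)
    then show ?thesis
      using bij_betw_permutations[OF bij] by simp
  qed
  have "det_linear L = (\<Sum>p | p permutes (UNIV :: 'n set).
      of_int (sign (map_permutation UNIV ?a p)) *
      (\<Prod>b\<in>Basis. L (map_permutation UNIV ?a p b) \<bullet> b))"
    unfolding det_linear_def by (rule sum.reindex_bij_betw[OF bijm, symmetric])
  also have "\<dots> = (\<Sum>p | p permutes (UNIV :: 'n set).
      of_int (sign p) * (\<Prod>i\<in>UNIV. matrix L $ i $ p i))"
  proof (rule sum.cong[OF refl])
    fix p assume "p \<in> {p. p permutes (UNIV :: 'n set)}"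
    then have p: "p permutes (UNIV :: 'n set)"
      by simp
    have "sign (map_permutation UNIV ?a p) = sign p"
      by (rule sign_map_permutation[OF inj p]) simp
    moreover have "(\<Prod>b\<in>Basis. L (map_permutation UNIV ?a p b) \<bullet> b)
        = (\<Prod>i\<in>UNIV. L (map_permutation UNIV ?a p (?a i)) \<bullet> ?a i)"
      by (rule prod.reindex_bij_betw[OF bij, symmetric])
    moreover have "\<dots> = (\<Prod>i\<in>UNIV. matrix L $ i $ p i)"
      by (simp add: map_permutation_apply[OF inj] matrix_def inner_axis)
    ultimately show "of_int (sign (map_permutation UNIV ?a p)) *
        (\<Prod>b\<in>Basis. L (map_permutation UNIV ?a p b) \<bullet> b)
        = of_int (sign p) * (\<Prod>i\<in>UNIV. matrix L $ i $ p i)"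
      by simp
  qed
  finally show ?thesis
    by (simp add: det_def)
qed

end

theory Submission
  imports Defs
begin

text \<open>A real linear map of the plane is \<open>h \<mapsto> a * h + b * cnj h\<close>.  Its adjoint sends a unit
  vector \<open>u\<close> to \<open>cnj a * u + b * cnj u\<close>, so that the supremum in \<open>K_CT\<close> is the norm of this vector, while the
  determinant is \<open>(norm a)\<^sup>2 - (norm b)\<^sup>2\<close>.  In the direction \<open>u = x / norm x\<close> the two terms
  partially cancel for the inverse of a map with dilatation \<open>x / (2 * cnj x)\<close>; the
  linear map \<open>x + i y \<mapsto> x + 2 i y\<close> shows the same effect on a whole open cone.\<close>

section \<open>Comparison of \<open>K_CT\<close> with \<open>K_I_inv\<close>, and the planar lower
  bound for the latter\<close>

text \<open>Cauchy-Schwarz gives the upper bound. The lower end 0 is recorded as well, because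
  monotonicity of \<open>powr\<close> in its base asks for a nonnegative base.\<close>

lemma directional_sup_le_onorm:
  fixes L :: "'a::euclidean_space \<Rightarrow> 'a"
  assumes "bounded_linear L" and "norm u \<le> 1"
  shows "(SUP h\<in>{h. norm h = 1}. \<bar>L h \<bullet> u\<bar>) \<in> {0..onorm L}"
proof -
  have bound: "\<bar>L h \<bullet> u\<bar> \<le> onorm L" if "norm h = 1" for h
  proof -
    have "\<bar>L h \<bullet> u\<bar> \<le> norm (L h) * norm u"
      by (rule Cauchy_Schwarz_ineq2)
    also have "\<dots> \<le> norm (L h)"
      using assms(2) by (simp add: mult_left_le)
    also have "\<dots> \<le> onorm L"
      using onorm[OF assms(1), of h] that by simp
    finally show ?thesis .
  qed
  obtain e :: 'a where e: "norm e = 1"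
    using norm_Basis nonempty_Basis by blast
  have "bdd_above ((\<lambda>h. \<bar>L h \<bullet> u\<bar>) ` {h. norm h = 1})"
    using bound by (auto intro!: bdd_aboveI2)
  then have "\<bar>L e \<bullet> u\<bar> \<le> (SUP h\<in>{h. norm h = 1}. \<bar>L h \<bullet> u\<bar>)"
    using e by (intro cSUP_upper) auto
  moreover have "(SUP h\<in>{h. norm h = 1}. \<bar>L h \<bullet> u\<bar>) \<le> onorm L"
    using e bound by (intro cSUP_least) auto
  ultimately show ?thesis
    using abs_ge_zero[of "L e \<bullet> u"] by auto
qed

lemma K_CT_le_K_I_inv:
  assumes "p \<ge> 0" and "K_defined_at y0 U g y"
  shows "K_CT p y0 U g y \<le> K_I_inv p U g y"
proof -
  define z where "z = the_inv_into U g y"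
  have "bounded_linear (frechet_derivative g (at z))"
    using assms(2) frechet_derivative_works has_derivative_bounded_linear
    unfolding K_defined_at_def z_def by blast
  \<comment> \<open>The normalised vector is a value of \<open>sgn\<close>, so its norm is 0 or 1,
    within the bound of the lemma.\<close>
  then have "(SUP h\<in>{h. norm h = 1}.
      \<bar>frechet_derivative g (at z) h \<bullet> ((g z - y0) /\<^sub>R norm (g z - y0))\<bar>)
    \<in> {0..onorm (frechet_derivative g (at z))}"
    by (rule directional_sup_le_onorm) (simp add: norm_sgn flip: sgn_div_norm)
  then show ?thesis
    using assms(1) unfolding K_CT_def K_I_inv_def Let_def z_def[symmetric]
    by (intro divide_right_mono powr_mono2) auto
qed

text \<open>Hadamard's inequality for the columns \<open>L 1\<close> and \<open>L \<i>\<close>: the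
  determinant is the imaginary part of \<open>cnj (L 1) * L \<i>\<close>, whose modulus is the
  product of the column lengths.\<close>

lemma abs_det_linear_le_onorm:
  fixes L :: "complex \<Rightarrow> complex"
  assumes "bounded_linear L"
  shows "\<bar>det_linear L\<bar> \<le> (onorm L)\<^sup>2"
proof -
  have "\<bar>det_linear L\<bar> = \<bar>Im (cnj (L 1) * L \<i>)\<bar>"
    by (simp add: det_linear_complex)
  also have "\<dots> \<le> norm (L 1) * norm (L \<i>)"
    using abs_Im_le_cmod[of "cnj (L 1) * L \<i>"] by (simp add: norm_mult)
  also have "\<dots> \<le> onorm L * onorm L"
    using onorm[OF assms, of 1] onorm[OF assms, of \<i>] onorm_pos_le[OF assms]
    by (intro mult_mono) auto
  finally show ?thesis
    by (simp add: power2_eq_square)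
qed

lemma K_I_inv_planar_ge_1:
  fixes g :: "complex \<Rightarrow> complex"
  assumes "K_defined_at y0 U g y"
  shows "1 \<le> K_I_inv 2 U g y"
proof -
  define z where "z = the_inv_into U g y"
  have L: "bounded_linear (frechet_derivative g (at z))" and J: "Jacobian z g \<noteq> 0"
    using assms frechet_derivative_works has_derivative_bounded_linear
    unfolding K_defined_at_def z_def by blast+
  then show ?thesis
    using abs_det_linear_le_onorm[OF L] onorm_pos_le[OF L]
    unfolding K_I_inv_def Let_def z_def[symmetric]
    by (simp add: Jacobian_def)
qed

section \<open>Closed form of \<open>K_CT\<close> for a derivative
  \<open>a * h + b * cnj h\<close>\<close>

text \<open>Equality in Cauchy-Schwarz occurs at \<open>sgn w\<close>; for \<open>w = 0\<close>
  every unit vector attains the value 0.\<close>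

lemma SUP_abs_inner_unit:
  fixes w :: "'a::euclidean_space"
  shows "(SUP h\<in>{h. norm h = 1}. \<bar>h \<bullet> w\<bar>) = norm w"
proof (rule cSup_eq_maximum)
  obtain e :: 'a where e: "norm e = 1"
    using norm_Basis nonempty_Basis by blast
  show "norm w \<in> (\<lambda>h. \<bar>h \<bullet> w\<bar>) ` {h. norm h = 1}"
  proof (cases "w = 0")
    case True
    then show ?thesis
      using e by force
  next
    case False
    have "sgn w \<bullet> w = norm w"
      using False by (simp add: sgn_div_norm norm_eq_sqrt_inner real_div_sqrt
          flip: divide_inverse_commute)
    then show ?thesis
      using False by (intro image_eqI[of _ _ "sgn w"]) (auto simp: norm_sgn)
  qed
  show "x \<le> norm w" if "x \<in> (\<lambda>h. \<bar>h \<bullet> w\<bar>) ` {h. norm h = 1}" for x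
    using that Cauchy_Schwarz_ineq2[of _ w]
    by (metis (mono_tags, lifting) imageE mem_Collect_eq mult_1)
qed

lemma Jacobian_eq:
  assumes "(g has_derivative (\<lambda>h. a * h + b * cnj h)) (at z)"
  shows "Jacobian z g = (norm a)\<^sup>2 - (norm b)\<^sup>2"
  unfolding Jacobian_def frechet_derivative_at[OF assms, symmetric] det_linear_complex
  unfolding cmod_power2 by (simp add: algebra_simps power2_eq_square)

text \<open>Passing to the adjoint leaves the plain supremum of \<open>SUP_abs_inner_unit\<close>.
  Stated at \<open>g z\<close>, so that injectivity turns \<open>the_inv_into\<close> back into
  \<open>z\<close>.\<close>

lemma K_CT_eq:
  assumes "inj_on g U" and "z \<in> U"
    and "(g has_derivative (\<lambda>h. a * h + b * cnj h)) (at z)"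
  shows "K_CT p y0 U g (g z)
    = norm (cnj a * sgn (g z - y0) + b * cnj (sgn (g z - y0))) powr p
      / \<bar>(norm a)\<^sup>2 - (norm b)\<^sup>2\<bar>"
proof -
  have "(a * h + b * cnj h) \<bullet> u = h \<bullet> (cnj a * u + b * cnj u)" for h u
    by (simp add: inner_complex_def algebra_simps)
  then show ?thesis
    unfolding K_CT_def Let_def the_inv_into_f_f[OF assms(1,2)] Jacobian_eq[OF assms(3)]
      frechet_derivative_at[OF assms(3), symmetric]
    by (simp only: sgn_div_norm[symmetric] SUP_abs_inner_unit)
qed

section \<open>Wirtinger derivatives and the inverse of a map with the given dilatation\<close>

text \<open>A real linear map is determined by its values at 1 and \<open>\<i>\<close>, which are
  the two partial derivatives; the Wirtinger pair is the change to the coordinates \<open>h\<close>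
  and \<open>cnj h\<close>.\<close>

lemma has_derivative_wirtinger:
  assumes "f differentiable (at x)"
  shows "(f has_derivative (\<lambda>h. wirtinger f x * h + wirtinger_bar f x * cnj h)) (at x)"
proof -
  obtain L where L: "(f has_derivative L) (at x)"
    using assms by (auto simp: differentiable_def)
  then interpret bounded_linear L
    by (rule has_derivative_bounded_linear)
  have dir: "((\<lambda>t::real. f (x + of_real t * c)) has_vector_derivative L c) (at 0)" for c
  proof -
    have "((\<lambda>t::real. f (x + of_real t * c)) has_derivative (\<lambda>t. L (of_real t * c))) (at 0)"
      by (rule has_derivative_compose[of "\<lambda>t::real. x + of_real t * c" _ _ _ f])
        (auto intro!: derivative_eq_intros L)
    then show ?thesis
      by (simp add: has_vector_derivative_def scaleR flip: scaleR_conv_of_real)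
  qed
  have p1: "partial1 f x = L 1" and p2: "partial2 f x = L \<i>"
    using dir[of 1] dir[of \<i>] unfolding partial1_def partial2_def
    by (simp_all add: vector_derivative_at)
  have "L h = wirtinger f x * h + wirtinger_bar f x * cnj h" for h
  proof -
    have "L h = L (Re h *\<^sub>R 1 + Im h *\<^sub>R \<i>)"
      by (rule arg_cong[where f = L]) (simp add: complex_eq_iff)
    also have "\<dots> = Re h *\<^sub>R L 1 + Im h *\<^sub>R L \<i>"
      by (simp add: add scaleR)
    also have "\<dots> = wirtinger f x * h + wirtinger_bar f x * cnj h"
      unfolding wirtinger_def wirtinger_bar_def p1 p2
      by (simp add: complex_eq_iff field_simps)
    finally show ?thesis .
  qed
  then show ?thesis
    using L by presburger
qed

text \<open>The coefficients come from solving \<open>w = a * h + b * cnj h\<close> together with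
  its conjugate for \<open>h\<close> by Cramer's rule, with determinant \<open>J\<close>. The
  inverse function theorem used here asks only for continuity on \<open>D\<close> and a right
  inverse of the derivative.\<close>

lemma has_derivative_the_inv_into:
  fixes f :: "complex \<Rightarrow> complex"
  assumes "open D" and "continuous_on D f" and "inj_on f D" and "x \<in> D"
    and f': "(f has_derivative (\<lambda>h. a * h + b * cnj h)) (at x)"
    and J: "J = (norm a)\<^sup>2 - (norm b)\<^sup>2" "J \<noteq> 0"
  shows "(the_inv_into D f has_derivative
           (\<lambda>h. cnj a / of_real J * h + - b / of_real J * cnj h)) (at (f x))"
proof (rule has_derivative_inverse_strong[OF assms(1,4,2) _ f'])
  show "the_inv_into D f (f y) = y" if "y \<in> D" for y
    using assms(3) that by (rule the_inv_into_f_f)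
  have "a * (cnj a / of_real J * h + - b / of_real J * cnj h)
      + b * cnj (cnj a / of_real J * h + - b / of_real J * cnj h) = h" for h
  proof -
    have "a * (cnj a / of_real J * h + - b / of_real J * cnj h)
        + b * cnj (cnj a / of_real J * h + - b / of_real J * cnj h)
      = (a * cnj a - b * cnj b) / of_real J * h"
      by (simp add: diff_divide_distrib algebra_simps)
    also have "a * cnj a - b * cnj b = of_real J"
      unfolding J(1) by (simp add: complex_norm_square flip: of_real_power)
    finally show ?thesis
      using J(2) by simp
  qed
  then show "(\<lambda>h. a * h + b * cnj h) \<circ>
      (\<lambda>h. cnj a / of_real J * h + - b / of_real J * cnj h) = id"
    by (simp add: fun_eq_iff)
qed

text \<open>The dilatation is tuned so that the \<open>cnj\<close> term cancels exactly half of the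
  other one in the radial direction. The first claim ensures that the value 1/3 is no artefact of
  totalised functions.\<close>

lemma inverse_of_dilatation_half:
  fixes f :: "complex \<Rightarrow> complex"
  assumes "is_domain D" and "homeo_onto_image D f" and "x \<in> D" and "x \<noteq> 0"
    and "f differentiable (at x)"
    and mu: "dilatation f x = 1 / 2 * (x / cnj x)"
  shows "K_defined_at 0 (f ` D) (the_inv_into D f) x"
    and "K_CT 2 0 (f ` D) (the_inv_into D f) x = 1 / 3"
proof -
  define g where "g = the_inv_into D f"
  define a where "a = wirtinger f x"
  define b where "b = wirtinger_bar f x"
  define J where "J = (norm a)\<^sup>2 - (norm b)\<^sup>2"
  have hom: "homeomorphism D (f ` D) f g"
    using assms(2) by (simp add: homeo_onto_image_def g_def)
  have gf: "g (f y) = y" if "y \<in> D" for y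
    using hom that by (rule homeomorphism_apply1)
  have inj: "inj_on f D"
    using gf by (rule inj_on_inverseI)
  have injg: "inj_on g (f ` D)"
    using gf by (auto simp: inj_on_def)
  \<comment> \<open>If \<open>a\<close> were 0, \<open>dilatation\<close> would take its default
    value 0, but the prescribed value is nonzero.\<close>
  have a0: "a \<noteq> 0" and b: "b = a * x / (2 * cnj x)"
    using mu \<open>x \<noteq> 0\<close> by (auto simp: dilatation_def a_def b_def field_simps split: if_splits)
  have "norm b = norm a / 2"
    using \<open>x \<noteq> 0\<close> by (simp add: b norm_mult norm_divide)
  then have "J = (norm a)\<^sup>2 - (norm a / 2)\<^sup>2"
    by (simp only: J_def)
  then have J: "J = 3 / 4 * (norm a)\<^sup>2"
    by (simp add: power_divide)
  have "J > 0"
    unfolding J using a0 by simp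
  have f': "(f has_derivative (\<lambda>h. a * h + b * cnj h)) (at x)"
    unfolding a_def b_def using assms(5) by (rule has_derivative_wirtinger)
  have g': "(g has_derivative
      (\<lambda>h. cnj a / of_real J * h + - b / of_real J * cnj h)) (at (f x))"
    unfolding g_def using assms(1) hom inj \<open>x \<in> D\<close> f' J_def \<open>J > 0\<close>
    by (intro has_derivative_the_inv_into) (auto simp: is_domain_def homeomorphism_def)
  have det: "(norm (cnj a / of_real J))\<^sup>2 - (norm (- b / of_real J))\<^sup>2 = 1 / J"
  proof -
    have "(norm (cnj a / of_real J))\<^sup>2 - (norm (- b / of_real J))\<^sup>2
        = ((norm a)\<^sup>2 - (norm b)\<^sup>2) / J\<^sup>2"
      by (simp add: norm_divide power_divide diff_divide_distrib)
    also have "\<dots> = J / J\<^sup>2"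
      by (simp only: J_def)
    finally show ?thesis
      using \<open>J > 0\<close> by (simp add: power2_eq_square)
  qed
  have inv: "the_inv_into (f ` D) g x = f x"
    using the_inv_into_f_f[OF injg, of "f x"] gf \<open>x \<in> D\<close> by simp
  show "K_defined_at 0 (f ` D) (the_inv_into D f) x"
    unfolding K_defined_at_def g_def[symmetric] inv
  proof (intro conjI)
    show "x \<in> g ` f ` D"
      using gf \<open>x \<in> D\<close> by force
    show "g differentiable at (f x)"
      using g' by (rule differentiableI)
    show "Jacobian (f x) g \<noteq> 0"
      unfolding Jacobian_eq[OF g'] det using \<open>J > 0\<close> by simp
  qed fact
  have sgn: "sgn x = x / of_real (norm x)"
    by (simp add: sgn_eq)
  \<comment> \<open>Since \<open>cnj (sgn x) = cnj x / norm x\<close>, the term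
    \<open>b * cnj (sgn x)\<close> equals \<open>a * sgn x / 2\<close>.\<close>
  have "cnj (cnj a / of_real J) * sgn x + - b / of_real J * cnj (sgn x)
      = a * sgn x / (2 * of_real J)"
    unfolding b sgn using \<open>x \<noteq> 0\<close> \<open>J > 0\<close> by (simp add: field_simps)
  moreover have "norm (a * sgn x / (2 * of_real J)) = norm a / (2 * J)"
    using \<open>x \<noteq> 0\<close> \<open>J > 0\<close> by (simp add: norm_mult norm_divide norm_sgn)
  ultimately have "K_CT 2 0 (f ` D) g (g (f x)) = (norm a / (2 * J)) powr 2 / \<bar>1 / J\<bar>"
    using gf \<open>x \<in> D\<close> by (subst K_CT_eq[OF injg _ g']) (simp_all only: det diff_zero imageI)
  \<comment> \<open>The quotient is \<open>(norm a)\<^sup>2 / (4 * J)\<close>, and \<open>J\<close>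
    is 3/4 of \<open>(norm a)\<^sup>2\<close>.\<close>
  also have "\<dots> = 1 / 3"
    using \<open>J > 0\<close> a0 by (simp add: powr_numeral J power2_eq_square field_simps)
  finally show "K_CT 2 0 (f ` D) (the_inv_into D f) x = 1 / 3"
    using gf \<open>x \<in> D\<close> by (simp add: g_def)
qed

section \<open>Strict inequality on a set of positive measure\<close>

lemma emeasure_lebesgue_open_pos:
  fixes S :: "'a::euclidean_space set"
  assumes "open S" and "S \<noteq> {}"
  shows "emeasure lebesgue S > 0"
proof -
  obtain x where "x \<in> S"
    using assms(2) by blast
  then obtain a b where "x \<in> box a b" "box a b \<subseteq> S"
    using assms(1) by (meson open_contains_box)
  then have "\<not> negligible S"
    using negligible_interval(2) negligible_subset by blast
  moreover have "S \<in> sets lebesgue"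
    using assms(1) by simp
  ultimately show ?thesis
    by (auto simp: negligible_iff_null_sets null_sets_def zero_less_iff_neq_zero)
qed

text \<open>With Jacobian 2 and a unit vector at angle \<open>t\<close>, \<open>K_CT\<close> is
  \<open>(cos t ^ 2 + 4 * sin t ^ 2) / 2\<close>, which is below 1 exactly near the horizontal
  directions.\<close>

lemma K_CT_less_1_on_cone:
  defines "g \<equiv> \<lambda>z. Complex (Re z) (2 * Im z)"
  shows "homeo_onto_image UNIV g" and "range g = UNIV"
    and "{y. K_defined_at 0 UNIV g y \<and> K_CT 2 0 UNIV g y < 1 \<and> 1 \<le> K_I_inv 2 UNIV g y}
      = {w. 2 * (Im w)\<^sup>2 < (Re w)\<^sup>2}"
proof -
  define k where "k = (\<lambda>w. Complex (Re w) (Im w / 2))"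
  have gk: "g (k w) = w" and kg: "k (g z) = z" for w z
    by (simp_all add: g_def k_def)
  have inj: "inj g"
    using kg by (rule inj_on_inverseI)
  show range: "range g = UNIV"
    using gk by (rule surjI)
  have inv: "the_inv_into UNIV g = k"
    using the_inv_into_f_f[OF inj] gk by (metis UNIV_I ext)
  have "continuous_on UNIV g" "continuous_on UNIV k"
    unfolding g_def k_def Complex_eq by (intro continuous_intros; simp)+
  then show "homeo_onto_image UNIV g"
    unfolding homeo_onto_image_def inv range
    using gk kg range surjI[of k g] by (auto simp: homeomorphism_def)
  \<comment> \<open>The coefficients are \<open>(1 + 2) / 2\<close> and \<open>(1 - 2) / 2\<close>,
    from the stretch factors 1 and 2; the Jacobian is 9/4 - 1/4 = 2.\<close>
  have g': "(g has_derivative (\<lambda>h. (3/2) * h + (- 1/2) * cnj h)) (at z)" for z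
  proof -
    have "g = (\<lambda>h. (3/2) * h + (- 1/2) * cnj h)"
      by (auto simp: g_def fun_eq_iff complex_eq_iff)
    then show ?thesis
      by (simp only:) (intro bounded_linear_imp_has_derivative bounded_linear_add
          bounded_linear_const_mult bounded_linear_ident bounded_linear_cnj)
  qed
  have def_iff: "K_defined_at 0 UNIV g w \<longleftrightarrow> w \<noteq> 0" for w
    unfolding K_defined_at_def range Jacobian_eq[OF g']
    using differentiableI[OF g'] by (auto simp: power2_eq_square)
  have CT: "K_CT 2 0 UNIV g w < 1 \<longleftrightarrow> 2 * (Im w)\<^sup>2 < (Re w)\<^sup>2" if "w \<noteq> 0" for w
  proof -
    \<comment> \<open>The stretch is self-adjoint, so its adjoint sends \<open>sgn w\<close> to the
      stretched \<open>w\<close> divided by \<open>norm w\<close>.\<close>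
    have "cnj (3/2) * sgn w + (- 1/2) * cnj (sgn w) = Complex (Re w) (2 * Im w) / of_real (norm w)"
      by (simp add: sgn_eq complex_eq_iff Re_divide_of_real Im_divide_of_real)
    then have "K_CT 2 0 UNIV g w = norm (Complex (Re w) (2 * Im w) / of_real (norm w)) powr 2 / 2"
      using K_CT_eq[OF inj UNIV_I g'[of "k w"], of 2 0] unfolding gk
      by (simp add: power2_eq_square)
    also have "\<dots> = ((Re w)\<^sup>2 + 4 * (Im w)\<^sup>2) / (2 * ((Re w)\<^sup>2 + (Im w)\<^sup>2))"
      by (simp add: norm_divide power_divide cmod_power2 power_mult_distrib)
    also have "\<dots> < 1 \<longleftrightarrow> (Re w)\<^sup>2 + 4 * (Im w)\<^sup>2 < 2 * ((Re w)\<^sup>2 + (Im w)\<^sup>2)"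
      using that by (subst divide_less_eq_1_pos)
        (simp_all only: complex_eq_iff zero_complex.sel zero_less_mult_iff sum_power2_gt_zero_iff, auto)
    finally show ?thesis
      by simp
  qed
  show "{y. K_defined_at 0 UNIV g y \<and> K_CT 2 0 UNIV g y < 1 \<and> 1 \<le> K_I_inv 2 UNIV g y}
      = {w. 2 * (Im w)\<^sup>2 < (Re w)\<^sup>2}"
  proof (intro Collect_cong)
    fix w
    show "(K_defined_at 0 UNIV g w \<and> K_CT 2 0 UNIV g w < 1 \<and> 1 \<le> K_I_inv 2 UNIV g w)
      \<longleftrightarrow> 2 * (Im w)\<^sup>2 < (Re w)\<^sup>2"
      using K_I_inv_planar_ge_1[of 0 UNIV g w] def_iff[of w] CT[of w]
      \<comment> \<open>The origin lies in neither set: \<open>K_defined_at\<close> fails there, and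
        the cone inequality is strict.\<close>
      by (cases "w = 0") auto
  qed
qed

lemma K_CT_less_1_positive_measure:
  "\<exists>(U::complex set) (V::complex set) g y0.
        is_domain U \<and> is_domain V \<and> homeo_onto_image U g \<and> g ` U = V \<and>
        (let S = {y. K_defined_at y0 U g y \<and> K_CT 2 y0 U g y < 1 \<and> 1 \<le> K_I_inv 2 U g y}
         in S \<in> sets lebesgue \<and> emeasure lebesgue S > 0)"
proof -
  let ?S = "{w::complex. 2 * (Im w)\<^sup>2 < (Re w)\<^sup>2}"
  have "open ?S"
    by (intro open_Collect_less continuous_intros)
  moreover have "1 \<in> ?S"
    by simp
  ultimately have "?S \<in> sets lebesgue \<and> emeasure lebesgue ?S > 0"
    by (intro conjI emeasure_lebesgue_open_pos) (simp, assumption, fast)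
  moreover have "is_domain (UNIV :: complex set)"
    by (simp add: is_domain_def convex_connected)
  ultimately show ?thesis
    using K_CT_less_1_on_cone unfolding Let_def
    by (intro exI[of _ UNIV] exI[of _ "\<lambda>z. Complex (Re z) (2 * Im z)"] exI[of _ 0]) simp
qed

theorem mainTheorem4:
  shows
    "(\<forall>(p::real) (y0::'a::euclidean_space) U g y.
        p > 0 \<and> is_domain U \<and> homeo_onto_image U g \<and> K_defined_at y0 U g y \<longrightarrow>
        K_CT p y0 U g y \<le> K_I_inv p U g y)
   \<and> (\<exists>(U::complex set) (V::complex set) g y0.
        is_domain U \<and> is_domain V \<and> homeo_onto_image U g \<and> g ` U = V \<and>
        (let S = {y. K_defined_at y0 U g y \<and> K_CT 2 y0 U g y < 1 \<and> 1 \<le> K_I_inv 2 U g y}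
         in S \<in> sets lebesgue \<and> emeasure lebesgue S > 0))
   \<and> (\<forall>(D::complex set) f x.
        is_domain D \<and> 0 \<in> D \<and> homeo_onto_image D f \<and> x \<in> D - {0} \<and>
        f differentiable (at x) \<and> Jacobian x f \<noteq> 0 \<and> dilatation f x = 1 / 2 * (x / cnj x) \<longrightarrow>
        K_defined_at 0 (f ` D) (the_inv_into D f) x \<and>
        K_CT 2 0 (f ` D) (the_inv_into D f) x = 1 / 3 \<and>
        K_CT 2 0 (f ` D) (the_inv_into D f) x < 1 \<and>
        K_I_inv 2 (f ` D) (the_inv_into D f) x \<ge> 1)"
  \<comment> \<open>The centre occurs only in the premise of \<open>K_I_inv_planar_ge_1\<close>,
    hence the explicit instance at 0.\<close>
  by (intro conjI allI impI K_CT_less_1_positive_measure)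
    (auto simp: K_CT_le_K_I_inv inverse_of_dilatation_half
      intro!: K_I_inv_planar_ge_1[of 0])

end
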